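(* Let $G$ be a Polish group, let $K/L$ be a non-abelian chief factor of $G$, and let $$\{1\} = G_0 \le G_1 \le \dots \le G_n = G$$ be a series of closed normal subgroups of $G$. Then there is exactly one $i \in \{0,\dots,n-1\}$ such that there exist closed normal subgroups $G_i \le B \le A \le G_{i+1}$ of $G$ for which $A/B$ is a non-abelian chief factor of $G$ associated to $K/L$.
   Context: A Polish group is a topological group whose topology is separable and completely metrizable. A normal factor of a topological group $G$ is a quotient $K/L$ where $L<K$ are distinct closed normal subgroups of $G$. It is a chief factor if there is no closed normal subgroup of $G$ lying strictly between $L$ and $K$. Normal factors $K_1/L_1$ and $K_2/L_2$ of $G$ are associated if $\overline{K_1L_2} = \overline{K_2L_1}$, $K_1 \cap \overline{L_1L_2} = L_1$, and $K_2 \cap \overline{L_1L_2} = L_2$. *)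

theory Defs
  imports "HOL-Analysis.Analysis" "HOL-Algebra.Coset"
begin

locale topological_group = group G for G (structure) +
  fixes T :: "'a topology"
  assumes topspace_eq: "topspace T = carrier G"
    and continuous_mult: "continuous_map (prod_topology T T) T (\<lambda>(x, y). x \<otimes> y)"
    and continuous_inv: "continuous_map T T (\<lambda>x. inv x)"

definition separable_space :: "'a topology \<Rightarrow> bool" where
  "separable_space T \<longleftrightarrow> (\<exists>D. countable D \<and> D \<subseteq> topspace T \<and> T closure_of D = topspace T)"

locale polish_group = topological_group +
  assumes separable: "separable_space T"
    and completely_metrizable: "completely_metrizable_space T"

definition closed_normal :: "('a, 'b) monoid_scheme \<Rightarrow> 'a topology \<Rightarrow> 'a set \<Rightarrow> bool" where
  "closed_normal G T N \<longleftrightarrow> N \<lhd> G \<and> closedin T N"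

text \<open>A factor \<open>K/L\<close> of \<open>G\<close> is represented by the pair \<open>K\<close>, \<open>L\<close>, since being chief and being
  associated depend on the subgroups themselves and not only on the quotient group.\<close>

definition normal_factor :: "('a, 'b) monoid_scheme \<Rightarrow> 'a topology \<Rightarrow> 'a set \<Rightarrow> 'a set \<Rightarrow> bool" where
  "normal_factor G T K L \<longleftrightarrow> closed_normal G T K \<and> closed_normal G T L \<and> L \<subset> K"

definition chief_factor :: "('a, 'b) monoid_scheme \<Rightarrow> 'a topology \<Rightarrow> 'a set \<Rightarrow> 'a set \<Rightarrow> bool" where
  "chief_factor G T K L \<longleftrightarrow>
     normal_factor G T K L \<and> \<not> (\<exists>N. closed_normal G T N \<and> L \<subset> N \<and> N \<subset> K)"

definition factor_group :: "('a, 'b) monoid_scheme \<Rightarrow> 'a set \<Rightarrow> 'a set \<Rightarrow> 'a set monoid" where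
  "factor_group G K L = (G\<lparr>carrier := K\<rparr>) Mod L"

text \<open>\<^const>\<open>comm_group\<close> also fails for structures that are not groups; the following fact shows
  that for normal factors its negation really means that the quotient group is not abelian.\<close>

lemma group_factor_group:
  assumes "normal_factor G T K L"
  shows "group (factor_group G K L)"
proof -
  have K: "K \<lhd> G" and L: "L \<lhd> G" and LK: "L \<subseteq> K"
    using assms by (auto simp: normal_factor_def closed_normal_def)
  interpret group G
    using K by (simp add: normal_def)
  have "L \<lhd> G\<lparr>carrier := K\<rparr>"
    using normal_restrict_supergroup[OF normal_imp_subgroup[OF K] L LK] .
  then show ?thesis
    unfolding factor_group_def by (rule normal.factorgroup_is_group)
qed

definition nonabelian_chief_factor ::
    "('a, 'b) monoid_scheme \<Rightarrow> 'a topology \<Rightarrow> 'a set \<Rightarrow> 'a set \<Rightarrow> bool" where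
  "nonabelian_chief_factor G T K L \<longleftrightarrow> chief_factor G T K L \<and> \<not> comm_group (factor_group G K L)"

definition associated_factors ::
    "('a, 'b) monoid_scheme \<Rightarrow> 'a topology \<Rightarrow> 'a set \<Rightarrow> 'a set \<Rightarrow> 'a set \<Rightarrow> 'a set \<Rightarrow> bool" where
  "associated_factors G T K1 L1 K2 L2 \<longleftrightarrow>
     T closure_of (K1 <#>\<^bsub>G\<^esub> L2) = T closure_of (K2 <#>\<^bsub>G\<^esub> L1) \<and>
     K1 \<inter> T closure_of (L1 <#>\<^bsub>G\<^esub> L2) = L1 \<and>
     K2 \<inter> T closure_of (L1 <#>\<^bsub>G\<^esub> L2) = L2"

end

theory Submission
  imports Defs
begin

text \<open>
  The proof compares a factor \<open>K/L\<close> with its centralizer \<open>C\<close>, the set of all \<open>g\<close> whose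
  commutators with \<open>K\<close> lie in \<open>L\<close>. It is a closed normal subgroup. If \<open>K/L\<close> is chief and
  non-abelian, then \<open>K \<inter> C = L\<close>, so that any closed normal subgroup outside \<open>C\<close> meets \<open>K\<close> outside
  \<open>L\<close> and hence, by chiefness, in a subgroup that generates a dense subgroup of \<open>K\<close> together
  with \<open>L\<close>.

  Uniqueness. Associated factors have the same centralizer. Were there suitable factors \<open>A/B\<close> and
  \<open>A'/B'\<close> in two different steps of the series, the lower one first, then \<open>A \<subseteq> B'\<close> would centralize
  \<open>A'/B'\<close>, hence also \<open>A/B\<close>, and \<open>A/B\<close> would be abelian.

  Existence. Since \<open>{1} \<subseteq> C\<close> and \<open>G\<close> is not contained in \<open>C\<close>, some step of the series goes from a
  subgroup \<open>P\<close> inside \<open>C\<close> to a subgroup \<open>Q\<close> outside \<open>C\<close>. Let \<open>A\<close> be the smallest closed normal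
  subgroup containing \<open>P\<close> and all commutators of \<open>K\<close> with \<open>Q\<close>, and let \<open>B = A \<inter> C\<close>. A closed
  normal subgroup \<open>N\<close> with \<open>B \<subset> N \<subseteq> A\<close> lies outside \<open>C\<close>, so \<open>N \<inter> K\<close> and \<open>L\<close> generate a dense
  subgroup of \<open>K\<close>. The commutators of \<open>Q\<close> with \<open>N \<inter> K\<close> lie in \<open>N\<close>, and those with \<open>L\<close> lie in
  \<open>L \<inter> A \<subseteq> B \<subseteq> N\<close>. By continuity, all commutators of \<open>Q\<close> with \<open>K\<close> lie in \<open>N\<close>, and \<open>N = A\<close> by
  minimality of \<open>A\<close>. So \<open>A/B\<close> is chief. It is associated to \<open>K/L\<close> because \<open>BL \<subseteq> C\<close>, where
  \<open>A \<inter> C = B\<close> and \<open>K \<inter> C = L\<close>, and because \<open>A\<close> and \<open>K\<close> agree up to \<open>B\<close> and \<open>L\<close>. It is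
  non-abelian since otherwise \<open>A \<inter> K\<close>, and with it \<open>K\<close>, would be commutative modulo \<open>L\<close>.
\<close>

section \<open>Commutators\<close>

definition (in group) commutator :: "'a \<Rightarrow> 'a \<Rightarrow> 'a"
  where "commutator x y = x \<otimes> y \<otimes> inv x \<otimes> inv y"

context group
begin

lemma inv_cancel_left:
  assumes "x \<in> carrier G" "y \<in> carrier G"
  shows "x \<otimes> (inv x \<otimes> y) = y" "inv x \<otimes> (x \<otimes> y) = y"
  using assms by (simp_all add: m_assoc[symmetric])

lemma commutator_closed:
  assumes "x \<in> carrier G" "y \<in> carrier G"
  shows "commutator x y \<in> carrier G"
  using assms by (simp add: commutator_def)

lemma inv_commutator:
  assumes "x \<in> carrier G" "y \<in> carrier G"
  shows "inv (commutator x y) = commutator y x"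
  using assms by (simp add: commutator_def inv_mult_group m_assoc)

lemma commutator_mult_right:
  assumes "x \<in> carrier G" "y \<in> carrier G" "z \<in> carrier G"
  shows "commutator x (y \<otimes> z) = commutator x y \<otimes> (y \<otimes> commutator x z \<otimes> inv y)"
  using assms by (simp add: commutator_def inv_mult_group m_assoc inv_cancel_left)

lemma commutator_inv_right:
  assumes "x \<in> carrier G" "y \<in> carrier G"
  shows "commutator x (inv y) = inv y \<otimes> commutator y x \<otimes> inv (inv y)"
  using assms by (simp add: commutator_def m_assoc inv_cancel_left)

lemma commutator_conjugate_right:
  assumes "x \<in> carrier G" "y \<in> carrier G" "h \<in> carrier G"
  shows "commutator x (h \<otimes> y \<otimes> inv h) = h \<otimes> commutator (inv h \<otimes> x \<otimes> inv (inv h)) y \<otimes> inv h"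
  using assms by (simp add: commutator_def inv_mult_group m_assoc inv_cancel_left)

lemma commutator_mem_iff_swap:
  assumes "subgroup H G" "x \<in> carrier G" "y \<in> carrier G"
  shows "commutator x y \<in> H \<longleftrightarrow> commutator y x \<in> H"
  using assms by (metis inv_commutator subgroup.m_inv_closed)

lemma commutator_mem_normal_right:
  assumes "N \<lhd> G" "x \<in> carrier G" "y \<in> N"
  shows "commutator x y \<in> N"
proof -
  interpret normal N G by fact
  show ?thesis
    using assms(2,3) inv_op_closed2[OF assms(2,3)] by (simp add: commutator_def)
qed

lemma commutator_mem_normal_left:
  assumes "N \<lhd> G" "x \<in> N" "y \<in> carrier G"
  shows "commutator x y \<in> N"
proof -
  interpret normal N G by fact
  show ?thesis
    using commutator_mem_normal_right[OF assms(1,3,2)]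
      commutator_mem_iff_swap[OF subgroup_axioms, of x y] assms by simp
qed

lemma normal_set_mult:
  assumes "X \<lhd> G" "Y \<lhd> G"
  shows "X <#> Y \<lhd> G"
proof -
  interpret X: normal X G by fact
  interpret Y: normal Y G by fact
  have mem: "x \<otimes> y \<in> X <#> Y" if "x \<in> X" "y \<in> Y" for x y
    using that by (auto simp: set_mult_def)
  show ?thesis
  proof (rule normal_invI)
    show "subgroup (X <#> Y) G"
    proof (rule subgroupI)
      show "X <#> Y \<subseteq> carrier G"
        by (simp add: setmult_subset_G X.subset Y.subset)
      show "X <#> Y \<noteq> {}"
        using mem X.one_closed Y.one_closed by blast
    next
      fix a assume "a \<in> X <#> Y"
      then obtain x y where xy: "x \<in> X" "y \<in> Y" "a = x \<otimes> y"
        by (auto simp: set_mult_def)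
      have "inv x \<otimes> (x \<otimes> inv y \<otimes> inv x) \<in> X <#> Y"
        using xy by (intro mem) (auto simp: Y.inv_op_closed2)
      then show "inv a \<in> X <#> Y"
        using xy by (simp add: inv_mult_group m_assoc inv_cancel_left)
    next
      fix a b assume "a \<in> X <#> Y" "b \<in> X <#> Y"
      then obtain x y x' y' where xy: "x \<in> X" "y \<in> Y" "a = x \<otimes> y" "x' \<in> X" "y' \<in> Y" "b = x' \<otimes> y'"
        by (auto simp: set_mult_def)
      have "(x \<otimes> (y \<otimes> x' \<otimes> inv y)) \<otimes> (y \<otimes> y') \<in> X <#> Y"
        using xy by (intro mem) (auto simp: X.inv_op_closed2)
      then show "a \<otimes> b \<in> X <#> Y"
        using xy by (simp add: m_assoc inv_cancel_left)
    qed
  next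
    fix g a assume g: "g \<in> carrier G" and "a \<in> X <#> Y"
    then obtain x y where xy: "x \<in> X" "y \<in> Y" "a = x \<otimes> y"
      by (auto simp: set_mult_def)
    have "(g \<otimes> x \<otimes> inv g) \<otimes> (g \<otimes> y \<otimes> inv g) \<in> X <#> Y"
      using xy g by (intro mem) (auto simp: X.inv_op_closed2 Y.inv_op_closed2)
    then show "g \<otimes> a \<otimes> inv g \<in> X <#> Y"
      using xy g by (simp add: m_assoc inv_cancel_left)
  qed
qed

lemma subset_set_mult:
  assumes "subgroup X G" "subgroup Y G"
  shows "X \<subseteq> X <#> Y" "Y \<subseteq> X <#> Y"
proof -
  show "X \<subseteq> X <#> Y"
  proof
    fix x assume "x \<in> X"
    moreover from this have "x = x \<otimes> \<one>"
      using assms by (simp add: subgroup.mem_carrier)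
    ultimately show "x \<in> X <#> Y"
      using subgroup.one_closed[OF assms(2)] unfolding set_mult_def by blast
  qed
  show "Y \<subseteq> X <#> Y"
  proof
    fix y assume "y \<in> Y"
    moreover from this have "y = \<one> \<otimes> y"
      using assms by (simp add: subgroup.mem_carrier)
    ultimately show "y \<in> X <#> Y"
      using subgroup.one_closed[OF assms(1)] unfolding set_mult_def by blast
  qed
qed

end

section \<open>Centralizers modulo a subgroup\<close>

text \<open>For normal subgroups \<open>L \<subseteq> K\<close> this is the centralizer of the factor \<open>K/L\<close>, the kernel of the
  action of \<open>G\<close> on it by conjugation. Allowing any set \<open>X\<close> in place of \<open>K\<close> turns
  ``\<open>Y\<close> centralizes \<open>X\<close> modulo \<open>L\<close>'' into a relation that is symmetric in \<open>X\<close> and \<open>Y\<close>, so that it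
  can be extended to closures in either argument.\<close>

definition (in group) mod_centralizer :: "'a set \<Rightarrow> 'a set \<Rightarrow> 'a set"
  where "mod_centralizer X L = {g \<in> carrier G. \<forall>x\<in>X. commutator x g \<in> L}"

context group
begin

lemma subset_mod_centralizer_swap:
  assumes "L \<lhd> G" "X \<subseteq> carrier G" "Y \<subseteq> mod_centralizer X L"
  shows "X \<subseteq> mod_centralizer Y L"
proof
  fix x assume x: "x \<in> X"
  have "commutator y x \<in> L" if "y \<in> Y" for y
    using that x assms commutator_mem_iff_swap[OF normal_imp_subgroup[OF assms(1)], of x y]
    by (auto simp: mod_centralizer_def)
  then show "x \<in> mod_centralizer Y L"
    using x assms(2) by (auto simp: mod_centralizer_def)
qed

lemma normal_subset_mod_centralizer:
  assumes "L \<lhd> G" "X \<subseteq> carrier G"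
  shows "L \<subseteq> mod_centralizer X L"
proof -
  interpret normal L G by fact
  show ?thesis
    using assms(2) commutator_mem_normal_right[OF assms(1)] by (auto simp: mod_centralizer_def)
qed

lemma subgroup_mod_centralizer:
  assumes L: "L \<lhd> G" and X: "X \<subseteq> carrier G"
  shows "subgroup (mod_centralizer X L) G"
proof -
  interpret normal L G by fact
  show ?thesis
  proof (rule subgroupI)
    show "mod_centralizer X L \<subseteq> carrier G"
      by (auto simp: mod_centralizer_def)
    show "mod_centralizer X L \<noteq> {}"
      using normal_subset_mod_centralizer[OF L X] one_closed by blast
  next
    fix a assume a: "a \<in> mod_centralizer X L"
    have "inv a \<otimes> commutator a x \<otimes> inv (inv a) \<in> L" if "x \<in> X" for x
      using that a X commutator_mem_iff_swap[OF subgroup_axioms, of a x]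
      by (intro inv_op_closed2) (auto simp: mod_centralizer_def)
    then show "inv a \<in> mod_centralizer X L"
      using a X by (auto simp: mod_centralizer_def commutator_inv_right subset_iff)
  next
    fix a b assume "a \<in> mod_centralizer X L" "b \<in> mod_centralizer X L"
    then show "a \<otimes> b \<in> mod_centralizer X L"
      using X by (auto simp: mod_centralizer_def commutator_mult_right subset_iff inv_op_closed2)
  qed
qed

lemma normal_mod_centralizer:
  assumes L: "L \<lhd> G" and K: "K \<lhd> G"
  shows "mod_centralizer K L \<lhd> G"
proof (rule normal_invI)
  have K': "K \<subseteq> carrier G"
    using K normal_imp_subgroup subgroup.subset by blast
  then show "subgroup (mod_centralizer K L) G"
    using subgroup_mod_centralizer L by blast
  fix h a assume h: "h \<in> carrier G" and a: "a \<in> mod_centralizer K L"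
  have "commutator x (h \<otimes> a \<otimes> inv h) \<in> L" if x: "x \<in> K" for x
  proof -
    have "inv h \<otimes> x \<otimes> inv (inv h) \<in> K"
      using normal.inv_op_closed2[OF K _ x, of "inv h"] h by simp
    then have "h \<otimes> commutator (inv h \<otimes> x \<otimes> inv (inv h)) a \<otimes> inv h \<in> L"
      using a h normal.inv_op_closed2[OF L h] by (simp add: mod_centralizer_def)
    moreover have "commutator x (h \<otimes> a \<otimes> inv h)
        = h \<otimes> commutator (inv h \<otimes> x \<otimes> inv (inv h)) a \<otimes> inv h"
      using x K' a h by (intro commutator_conjugate_right) (auto simp: mod_centralizer_def)
    ultimately show ?thesis
      by simp
  qed
  then show "h \<otimes> a \<otimes> inv h \<in> mod_centralizer K L"
    using a h by (simp add: mod_centralizer_def)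
qed

text \<open>This is the identity \<open>ab = [a, b]ba\<close> read modulo \<open>L\<close>.\<close>

lemma r_coset_mult_commute_iff:
  assumes L: "subgroup L G" and a: "a \<in> carrier G" and b: "b \<in> carrier G"
  shows "L #> (a \<otimes> b) = L #> (b \<otimes> a) \<longleftrightarrow> commutator a b \<in> L"
proof -
  have eq: "a \<otimes> b = commutator a b \<otimes> (b \<otimes> a)"
    using a b by (simp add: commutator_def m_assoc inv_cancel_left)
  show ?thesis
  proof
    assume "L #> (a \<otimes> b) = L #> (b \<otimes> a)"
    then have "a \<otimes> b \<in> L #> (b \<otimes> a)"
      using rcos_self[OF _ L, of "a \<otimes> b"] a b by simp
    then obtain l where l: "l \<in> L" "a \<otimes> b = l \<otimes> (b \<otimes> a)"
      by (auto simp: r_coset_def)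
    then have "commutator a b = l"
      using eq a b commutator_closed[OF a b] subgroup.mem_carrier[OF L l(1)] by simp
    with l show "commutator a b \<in> L"
      by simp
  next
    assume "commutator a b \<in> L"
    then have "a \<otimes> b \<in> L #> (b \<otimes> a)"
      using eq by (auto simp: r_coset_def)
    then show "L #> (a \<otimes> b) = L #> (b \<otimes> a)"
      using repr_independence[OF _ _ L] a b by simp
  qed
qed

lemma comm_factor_group_iff:
  assumes K: "K \<lhd> G" and L: "L \<lhd> G" and LK: "L \<subseteq> K"
  shows "comm_group (factor_group G K L) \<longleftrightarrow> K \<subseteq> mod_centralizer K L"
proof -
  interpret K: normal K G by fact
  interpret KL: normal L "G\<lparr>carrier := K\<rparr>"
    using normal_restrict_supergroup[OF normal_imp_subgroup[OF K] L LK] .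
  have carrier: "carrier (factor_group G K L) = (\<lambda>x. L #> x) ` K"
    unfolding factor_group_def carrier_FactGroup by (simp add: r_coset_def)
  have mult: "(L #> a) \<otimes>\<^bsub>factor_group G K L\<^esub> (L #> b) = L #> (a \<otimes> b)" if "a \<in> K" "b \<in> K" for a b
    using KL.rcos_sum[of a b] that
    by (simp add: factor_group_def r_coset_def)
  have group: "group (factor_group G K L)"
    unfolding factor_group_def by (rule KL.factorgroup_is_group)
  have "comm_group (factor_group G K L)
    \<longleftrightarrow> (\<forall>a\<in>K. \<forall>b\<in>K. L #> (a \<otimes> b) = L #> (b \<otimes> a))" (is "?c \<longleftrightarrow> ?r")
  proof
    assume c: ?c
    show ?r
    proof (intro ballI)
      fix a b assume ab: "a \<in> K" "b \<in> K"
      have "(L #> a) \<otimes>\<^bsub>factor_group G K L\<^esub> (L #> b) = (L #> b) \<otimes>\<^bsub>factor_group G K L\<^esub> (L #> a)"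
        using ab carrier
        by (intro comm_monoid.m_comm comm_group.axioms(1)[OF c]) auto
      then show "L #> (a \<otimes> b) = L #> (b \<otimes> a)"
        using ab by (simp add: mult)
    qed
  next
    assume ?r
    then show ?c
      using carrier mult
      by (intro group.group_comm_groupI[OF group]) auto
  qed
  also have "\<dots> \<longleftrightarrow> (\<forall>a\<in>K. \<forall>b\<in>K. commutator a b \<in> L)"
    using r_coset_mult_commute_iff[OF normal_imp_subgroup[OF L]] by simp
  also have "\<dots> \<longleftrightarrow> K \<subseteq> mod_centralizer K L"
    by (auto simp: mod_centralizer_def)
  finally show ?thesis .
qed

end

section \<open>Closed normal subgroups\<close>

context topological_group
begin

abbreviation cl :: "'a set \<Rightarrow> 'a set"
  where "cl X \<equiv> T closure_of X"

lemma continuous_map_group_mult: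
  assumes "continuous_map X T f" "continuous_map X T g"
  shows "continuous_map X T (\<lambda>x. f x \<otimes> g x)"
  using continuous_map_compose[OF continuous_map_pairedI[OF assms] continuous_mult]
  by (simp add: o_def)

lemma continuous_map_group_inv:
  assumes "continuous_map X T f"
  shows "continuous_map X T (\<lambda>x. inv f x)"
  using continuous_map_compose[OF assms continuous_inv] by (simp add: o_def)

lemma closed_normal_subset: "closed_normal G T N \<Longrightarrow> N \<subseteq> carrier G"
  by (meson closed_normal_def normal_imp_subgroup subgroup.subset)

lemma closed_normal_subgroup: "closed_normal G T N \<Longrightarrow> subgroup N G"
  by (meson closed_normal_def normal_imp_subgroup)

text \<open>For a fixed \<open>x\<close> the map \<open>g \<mapsto> [x, g]\<close> is continuous, so the centralizer is an intersection of
  closed preimages of \<open>L\<close>.\<close>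

lemma closedin_mod_centralizer:
  assumes L: "closedin T L" and X: "X \<subseteq> carrier G"
  shows "closedin T (mod_centralizer X L)"
proof -
  have "closedin T {g \<in> topspace T. commutator x g \<in> L}" if "x \<in> X" for x
  proof (rule closedin_continuous_map_preimage[OF _ L])
    show "continuous_map T T (commutator x)"
      unfolding commutator_def using that X topspace_eq
      by (intro continuous_map_group_mult continuous_map_group_inv) auto
  qed
  then have "closedin T (topspace T \<inter> (\<Inter>x\<in>X. {g \<in> topspace T. commutator x g \<in> L}))"
    by (cases "X = {}") (auto intro!: closedin_Int closedin_INT)
  moreover have "topspace T \<inter> (\<Inter>x\<in>X. {g \<in> topspace T. commutator x g \<in> L}) = mod_centralizer X L"
    using topspace_eq by (auto simp: mod_centralizer_def)
  ultimately show ?thesis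
    by simp
qed

lemma closed_normal_mod_centralizer:
  assumes "closed_normal G T L" "closed_normal G T K"
  shows "closed_normal G T (mod_centralizer K L)"
  using assms closedin_mod_centralizer closed_normal_subset normal_mod_centralizer
  by (simp add: closed_normal_def)

lemma closed_normal_Inter:
  assumes "\<N> \<noteq> {}" "\<And>N. N \<in> \<N> \<Longrightarrow> closed_normal G T N"
  shows "closed_normal G T (\<Inter>\<N>)"
proof -
  have "subgroup (\<Inter>\<N>) G"
    using assms closed_normal_subgroup by (intro subgroups_Inter) auto
  moreover have "x \<otimes> h \<otimes> inv x \<in> \<Inter>\<N>" if "x \<in> carrier G" "h \<in> \<Inter>\<N>" for x h
    using that assms(2) by (auto simp: closed_normal_def normal_inv_iff)
  ultimately have "\<Inter>\<N> \<lhd> G"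
    by (intro normal_invI)
  moreover have "closedin T (\<Inter>\<N>)"
    using assms by (intro closedin_Inter) (auto simp: closed_normal_def)
  ultimately show ?thesis
    by (simp add: closed_normal_def)
qed

lemma closed_normal_Int:
  assumes "closed_normal G T M" "closed_normal G T N"
  shows "closed_normal G T (M \<inter> N)"
  using closed_normal_Inter[of "{M, N}"] assms by auto

lemma closed_normal_hull:
  assumes "X \<subseteq> carrier G"
  shows "closed_normal G T (closed_normal G T hull X)"
proof -
  have "closed_normal G T (carrier G)"
    using normal_invI[OF subgroup_self] closedin_topspace[of T] topspace_eq
    by (simp add: closed_normal_def)
  then show ?thesis
    unfolding hull_def using assms by (intro closed_normal_Inter) auto
qed

text \<open>The group operations are continuous, so they map the closure of \<open>N\<close> (or of \<open>N \<times> N\<close>) into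
  the closure of the image, which is part of \<open>N\<close>.\<close>

lemma closed_normal_closure:
  assumes "N \<lhd> G"
  shows "closed_normal G T (cl N)"
proof -
  interpret normal N G by fact
  have sub: "N \<subseteq> cl N"
    using subset topspace_eq by (intro closure_of_subset) auto
  have closed: "cl N \<subseteq> carrier G"
    using closure_of_subset_topspace topspace_eq by metis
  have map: "f x \<in> cl N"
    if f: "continuous_map T T f" "f ` N \<subseteq> N" "x \<in> cl N" for f x
    using continuous_map_image_closure_subset[OF f(1), of N] closure_of_mono[OF f(2), of T] f(3)
    by blast
  have "subgroup (cl N) G"
  proof (rule subgroupI)
    show "cl N \<noteq> {}"
      using sub one_closed by blast
  next
    fix a assume "a \<in> cl N"
    then show "inv a \<in> cl N"
      by (intro map[of "\<lambda>a. inv a"] continuous_map_group_inv) auto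
  next
    fix a b assume "a \<in> cl N" "b \<in> cl N"
    then have "(a, b) \<in> prod_topology T T closure_of (N \<times> N)"
      by (simp add: closure_of_Times)
    then have "a \<otimes> b \<in> cl ((\<lambda>(x, y). x \<otimes> y) ` (N \<times> N))"
      using continuous_map_image_closure_subset[OF continuous_mult, of "N \<times> N"] by force
    moreover have "(\<lambda>(x, y). x \<otimes> y) ` (N \<times> N) \<subseteq> N"
      by auto
    ultimately show "a \<otimes> b \<in> cl N"
      using closure_of_mono by blast
  qed (rule closed)
  moreover have "g \<otimes> a \<otimes> inv g \<in> cl N" if "g \<in> carrier G" "a \<in> cl N" for g a
    using that topspace_eq
    by (intro map[of "\<lambda>a. g \<otimes> a \<otimes> inv g"] continuous_map_group_mult) (auto simp: inv_op_closed2)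
  ultimately show ?thesis
    using normal_invI by (simp add: closed_normal_def)
qed

lemma closed_normal_closure_set_mult:
  assumes "closed_normal G T X" "closed_normal G T Y"
  shows "closed_normal G T (cl (X <#> Y))"
  using assms by (simp add: closed_normal_def[of _ _ X] closed_normal_def[of _ _ Y]
      closed_normal_closure normal_set_mult)

lemma subset_closure_set_mult:
  assumes "closed_normal G T X" "closed_normal G T Y"
  shows "X \<subseteq> cl (X <#> Y)" "Y \<subseteq> cl (X <#> Y)"
proof -
  have "X <#> Y \<subseteq> cl (X <#> Y)"
    using assms closed_normal_subset topspace_eq
    by (intro closure_of_subset) (simp add: setmult_subset_G)
  then show "X \<subseteq> cl (X <#> Y)" "Y \<subseteq> cl (X <#> Y)"
    using subset_set_mult assms closed_normal_subgroup by blast+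
qed

lemma closure_set_mult_subset:
  assumes P: "subgroup P G" "closedin T P" and sub: "X \<subseteq> P" "Y \<subseteq> P"
  shows "cl (X <#> Y) \<subseteq> P"
proof (rule closure_of_minimal[OF _ P(2)])
  show "X <#> Y \<subseteq> P"
    using sub subgroup.m_closed[OF P(1)] by (auto simp: set_mult_def)
qed

text \<open>The form in which density of \<open>XY\<close> is used: a centralizing property modulo a closed subgroup
  passes from \<open>X\<close> and \<open>Y\<close> to the closure of \<open>XY\<close>.\<close>

lemma closure_set_mult_subset_mod_centralizer:
  assumes "closed_normal G T L" "Z \<subseteq> carrier G"
    and "X \<subseteq> mod_centralizer Z L" "Y \<subseteq> mod_centralizer Z L"
  shows "cl (X <#> Y) \<subseteq> mod_centralizer Z L"
  using assms closure_set_mult_subset subgroup_mod_centralizer closedin_mod_centralizer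
  by (simp add: closed_normal_def)

section \<open>Associated factors have the same centralizer\<close>

text \<open>If \<open>g\<close> centralizes \<open>K1/L1\<close>, its commutators with \<open>K1\<close> and with \<open>L2\<close> lie in
  \<open>cl (L1 L2)\<close>. By continuity so do those with \<open>K2\<close>, and as they lie in \<open>K2\<close> as well, they lie in
  \<open>L2\<close>.\<close>

lemma mod_centralizer_subset:
  assumes cn: "closed_normal G T K1" "closed_normal G T L1"
      "closed_normal G T K2" "closed_normal G T L2"
    and K2: "K2 \<subseteq> cl (K1 <#> L2)"
    and L2: "K2 \<inter> cl (L1 <#> L2) \<subseteq> L2"
  shows "mod_centralizer K1 L1 \<subseteq> mod_centralizer K2 L2"
proof
  fix g assume g: "g \<in> mod_centralizer K1 L1"
  let ?D = "cl (L1 <#> L2)"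
  have gG: "g \<in> carrier G"
    using g by (simp add: mod_centralizer_def)
  have D: "closed_normal G T ?D" "L1 \<subseteq> ?D" "L2 \<subseteq> ?D"
    using closed_normal_closure_set_mult[OF cn(2,4)] subset_closure_set_mult[OF cn(2,4)] by auto
  note DN = D(1)[unfolded closed_normal_def, THEN conjunct1]
  have "K1 \<subseteq> mod_centralizer {g} ?D"
  proof (rule subset_mod_centralizer_swap[OF DN closed_normal_subset[OF cn(1)]])
    show "{g} \<subseteq> mod_centralizer K1 ?D"
      using g D(2) by (auto simp: mod_centralizer_def)
  qed
  moreover have "L2 \<subseteq> mod_centralizer {g} ?D"
    using order_trans[OF D(3) normal_subset_mod_centralizer[OF DN]] gG by simp
  ultimately have "K2 \<subseteq> mod_centralizer {g} ?D"
    using order_trans[OF K2 closure_set_mult_subset_mod_centralizer[OF D(1)]] gG by simp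
  then have "{g} \<subseteq> mod_centralizer K2 ?D"
    using gG by (metis empty_subsetI insert_subset subset_mod_centralizer_swap[OF DN])
  moreover have "commutator x g \<in> K2" if "x \<in> K2" for x
    using commutator_mem_normal_left[OF _ that gG] cn(3) by (simp add: closed_normal_def)
  ultimately show "g \<in> mod_centralizer K2 L2"
    using L2 by (auto simp: mod_centralizer_def)
qed

lemma associated_factors_mod_centralizer_eq:
  assumes "normal_factor G T K1 L1" "normal_factor G T K2 L2" "associated_factors G T K1 L1 K2 L2"
  shows "mod_centralizer K1 L1 = mod_centralizer K2 L2"
proof -
  have cn: "closed_normal G T K1" "closed_normal G T L1"
      "closed_normal G T K2" "closed_normal G T L2"
    using assms by (auto simp: normal_factor_def)
  have comm: "L1 <#> L2 = L2 <#> L1"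
    using commut_normal[OF closed_normal_subgroup[OF cn(2)]] cn(4) by (simp add: closed_normal_def)
  have eq: "cl (K1 <#> L2) = cl (K2 <#> L1)"
    using assms(3) by (simp add: associated_factors_def)
  have "K1 \<subseteq> cl (K2 <#> L1)" "K2 \<subseteq> cl (K1 <#> L2)"
    using subset_closure_set_mult(1)[OF cn(1,4)] subset_closure_set_mult(1)[OF cn(3,2)] eq by auto
  moreover have "K1 \<inter> cl (L2 <#> L1) \<subseteq> L1" "K2 \<inter> cl (L1 <#> L2) \<subseteq> L2"
    using assms(3) comm by (simp_all add: associated_factors_def)
  ultimately show ?thesis
    using mod_centralizer_subset[OF cn] mod_centralizer_subset[OF cn(3,4,1,2)] by blast
qed

section \<open>Non-abelian chief factors\<close>

lemma chief_factor_eqI: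
  assumes "chief_factor G T K L" "closed_normal G T N" "L \<subset> N" "N \<subseteq> K"
  shows "N = K"
  using assms by (auto simp: chief_factor_def)

lemma chief_factor_closure_set_mult:
  assumes chief: "chief_factor G T K L" and R: "closed_normal G T R" "R \<subseteq> K" "\<not> R \<subseteq> L"
  shows "cl (R <#> L) = K"
proof (rule chief_factor_eqI[OF chief])
  have cn: "closed_normal G T K" "closed_normal G T L" "L \<subseteq> K"
    using chief by (auto simp: chief_factor_def normal_factor_def)
  show "closed_normal G T (cl (R <#> L))"
    using closed_normal_closure_set_mult R cn by blast
  show "L \<subset> cl (R <#> L)"
    using subset_closure_set_mult[OF R(1) cn(2)] R(3) by blast
  show "cl (R <#> L) \<subseteq> K"
    using closure_set_mult_subset[OF closed_normal_subgroup[OF cn(1)]] R(2) cn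
    by (simp add: closed_normal_def)
qed

lemma nonabelian_chief_factorD:
  assumes "nonabelian_chief_factor G T K L"
  shows "chief_factor G T K L" "normal_factor G T K L"
    "closed_normal G T K" "closed_normal G T L" "L \<subseteq> K"
    "\<not> K \<subseteq> mod_centralizer K L"
  using assms comm_factor_group_iff
  by (auto simp: nonabelian_chief_factor_def chief_factor_def normal_factor_def closed_normal_def)

text \<open>The intersection lies between \<open>L\<close> and \<open>K\<close>, and it is not \<open>K\<close>, as \<open>K/L\<close> is non-abelian.\<close>

lemma nonabelian_chief_factor_Int_mod_centralizer:
  assumes "nonabelian_chief_factor G T K L"
  shows "K \<inter> mod_centralizer K L = L"
proof (rule ccontr)
  note D = nonabelian_chief_factorD[OF assms]
  assume "K \<inter> mod_centralizer K L \<noteq> L"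
  moreover have "L \<subseteq> mod_centralizer K L"
    using normal_subset_mod_centralizer D closed_normal_subset by (simp add: closed_normal_def)
  ultimately have "K \<inter> mod_centralizer K L = K"
    using D by (intro chief_factor_eqI[OF D(1)] closed_normal_Int closed_normal_mod_centralizer) auto
  then show False
    using D(6) by blast
qed

text \<open>Some commutator of \<open>K\<close> with \<open>X\<close> is not in \<open>L\<close>; it lies in \<open>N\<close>, and also in the normal subgroup
  \<open>K\<close>. So \<open>N \<inter> K\<close> is not contained in \<open>L\<close>, and chiefness gives density.\<close>

lemma chief_factor_closure_Int_set_mult:
  assumes chief: "chief_factor G T K L" and N: "closed_normal G T N"
    and X: "X \<subseteq> mod_centralizer K N" "\<not> X \<subseteq> mod_centralizer K L"
  shows "\<not> N \<inter> K \<subseteq> L" "cl ((N \<inter> K) <#> L) = K"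
proof -
  have cn: "closed_normal G T K"
    using chief by (auto simp: chief_factor_def normal_factor_def)
  obtain g x where "g \<in> X" "g \<in> carrier G" "x \<in> K" "commutator x g \<in> N" "commutator x g \<notin> L"
    using X by (auto simp: mod_centralizer_def)
  moreover from this have "commutator x g \<in> K"
    using commutator_mem_normal_left cn by (simp add: closed_normal_def)
  ultimately show "\<not> N \<inter> K \<subseteq> L"
    by blast
  then show "cl ((N \<inter> K) <#> L) = K"
    using closed_normal_Int[OF N cn] by (intro chief_factor_closure_set_mult[OF chief]) auto
qed

section \<open>Finding an associated factor between two subgroups\<close>

text \<open>The factor \<open>A/B\<close> is the one described at the beginning: \<open>A\<close> is chosen as small as possible
  subject to containing \<open>P\<close> and the commutators of \<open>K\<close> with \<open>Q\<close>, which makes \<open>A/B\<close> chief, while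
  \<open>B = A \<inter> C\<close> is forced by the requirement that \<open>A/B\<close> has the same centralizer \<open>C\<close> as
  \<open>K/L\<close>: a non-abelian chief factor \<open>A/B\<close> with centralizer \<open>C\<close> satisfies \<open>A \<inter> C = B\<close>.\<close>

lemma associated_nonabelian_chief_factor_between:
  assumes KL: "nonabelian_chief_factor G T K L"
    and P: "closed_normal G T P" and Q: "closed_normal G T Q" and PQ: "P \<subseteq> Q"
    and PC: "P \<subseteq> mod_centralizer K L" and QC: "\<not> Q \<subseteq> mod_centralizer K L"
  obtains A B where "closed_normal G T A" "closed_normal G T B" "P \<subseteq> B" "B \<subseteq> A" "A \<subseteq> Q"
    "nonabelian_chief_factor G T A B" "associated_factors G T A B K L"
proof -
  note D = nonabelian_chief_factorD[OF KL]
  define C where "C = mod_centralizer K L"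
  define E where "E = P \<union> {commutator k q | k q. k \<in> K \<and> q \<in> Q}"
  define A where "A = closed_normal G T hull E"
  define B where "B = A \<inter> C"
  have KG: "K \<subseteq> carrier G" and QG: "Q \<subseteq> carrier G" and PG: "P \<subseteq> carrier G"
    using D P Q closed_normal_subset by auto
  have normal: "K \<lhd> G" "L \<lhd> G" "Q \<lhd> G"
    using D Q by (auto simp: closed_normal_def)
  have C: "closed_normal G T C"
    unfolding C_def using closed_normal_mod_centralizer D by blast
  have LC: "L \<subseteq> C"
    unfolding C_def using normal_subset_mod_centralizer normal KG by blast
  have KC: "K \<inter> C = L"
    unfolding C_def by (rule nonabelian_chief_factor_Int_mod_centralizer[OF KL])
  have A: "closed_normal G T A"
    unfolding A_def using KG QG PG
    by (intro closed_normal_hull) (auto simp: E_def subset_iff commutator_closed)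
  have EA: "E \<subseteq> A"
    unfolding A_def by (rule hull_subset)
  have A_minimal: "A \<subseteq> N" if "closed_normal G T N" "P \<subseteq> N" "Q \<subseteq> mod_centralizer K N" for N
    unfolding A_def using that
    by (intro hull_minimal) (auto simp: E_def mod_centralizer_def)
  have QA: "Q \<subseteq> mod_centralizer K A"
    using EA QG unfolding E_def mod_centralizer_def by blast
  have PA: "P \<subseteq> A"
    using EA by (auto simp: E_def)
  have B: "closed_normal G T B"
    unfolding B_def by (intro closed_normal_Int A C)
  have AQ: "A \<subseteq> Q"
    using QG commutator_mem_normal_right[OF normal(3)] KG PQ Q
    by (intro A_minimal) (auto simp: mod_centralizer_def)
  have AK: "\<not> A \<inter> K \<subseteq> L" "cl ((A \<inter> K) <#> L) = K"
    using chief_factor_closure_Int_set_mult[OF D(1) A QA QC] by auto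
  have BA: "B \<subset> A"
    using AK(1) KC by (auto simp: B_def)
  have PB: "P \<subseteq> B"
    using PA PC by (simp add: B_def C_def)

  have "N = A" if N: "closed_normal G T N" "B \<subset> N" "N \<subseteq> A" for N
  proof
    have NN: "N \<lhd> G" and NG: "N \<subseteq> carrier G"
      using N closed_normal_subset by (auto simp: closed_normal_def)
    have "N \<subseteq> mod_centralizer K N"
      using normal_subset_mod_centralizer[OF NN KG] .
    moreover have "\<not> N \<subseteq> mod_centralizer K L"
      using N by (auto simp: B_def C_def)
    ultimately have NK: "cl ((N \<inter> K) <#> L) = K"
      by (rule chief_factor_closure_Int_set_mult(2)[OF D(1) N(1)])
    have "N \<inter> K \<subseteq> mod_centralizer Q N"
      using normal_subset_mod_centralizer[OF NN QG] by blast
    moreover have "L \<subseteq> mod_centralizer Q N"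
    proof (rule subset_mod_centralizer_swap[OF NN])
      have "commutator l q \<in> N" if "l \<in> L" "q \<in> Q" for l q
      proof -
        have "commutator l q \<in> L"
          using that QG commutator_mem_normal_left[OF normal(2)] by blast
        moreover have "commutator l q \<in> A"
          using that QA D(5) by (auto simp: mod_centralizer_def)
        ultimately show ?thesis
          using LC N(2) by (auto simp: B_def)
      qed
      then show "Q \<subseteq> mod_centralizer L N"
        using QG by (auto simp: mod_centralizer_def)
      show "L \<subseteq> carrier G"
        using D(5) KG by blast
    qed
    ultimately have "K \<subseteq> mod_centralizer Q N"
      using closure_set_mult_subset_mod_centralizer[OF N(1) QG] NK by metis
    then have "Q \<subseteq> mod_centralizer K N"
      by (rule subset_mod_centralizer_swap[OF NN QG])
    then show "A \<subseteq> N"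
      using A_minimal N PB by blast
  qed (rule N)
  then have chief: "chief_factor G T A B"
    using A B BA unfolding chief_factor_def normal_factor_def by blast

  have "\<not> comm_group (factor_group G A B)"
  proof
    assume "comm_group (factor_group G A B)"
    then have "A \<subseteq> mod_centralizer A B"
      using comm_factor_group_iff A B BA by (auto simp: closed_normal_def)
    \<comment> \<open>Commutators of elements of \<open>A \<inter> K\<close> then lie in \<open>B \<inter> K \<subseteq> C \<inter> K = L\<close>.\<close>
    then have "A \<inter> K \<subseteq> mod_centralizer (A \<inter> K) L"
      using commutator_mem_normal_right[OF normal(1)] KG KC
      by (auto simp: mod_centralizer_def B_def subset_iff)
    then have "K \<subseteq> mod_centralizer (A \<inter> K) L"
      using closure_set_mult_subset_mod_centralizer[OF D(4), of "A \<inter> K" "A \<inter> K" L]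
        normal_subset_mod_centralizer[OF normal(2), of "A \<inter> K"] AK(2) KG by auto
    then have "A \<inter> K \<subseteq> C"
      unfolding C_def using KG by (metis le_infI2 subset_mod_centralizer_swap[OF normal(2)])
    then show False
      using AK(1) KC by blast
  qed
  with chief have nonabelian: "nonabelian_chief_factor G T A B"
    by (simp add: nonabelian_chief_factor_def)

  have AL: "closed_normal G T (cl (A <#> L))" "A \<subseteq> cl (A <#> L)"
      "L \<subseteq> cl (A <#> L)"
    and KB: "closed_normal G T (cl (K <#> B))" "K \<subseteq> cl (K <#> B)"
      "B \<subseteq> cl (K <#> B)"
    using closed_normal_closure_set_mult subset_closure_set_mult A B D by auto
  have "cl (A <#> L) = cl (K <#> B)"
  proof
    have "Q \<subseteq> mod_centralizer K (cl (K <#> B))"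
      using commutator_mem_normal_left[OF normal(1)] KB(2) QG by (auto simp: mod_centralizer_def)
    then have "A \<subseteq> cl (K <#> B)"
      using A_minimal KB PB by blast
    then show "cl (A <#> L) \<subseteq> cl (K <#> B)"
      using closure_set_mult_subset closed_normal_subgroup KB D(5)
      by (meson closed_normal_def order_trans)
    have "cl ((A \<inter> K) <#> L) \<subseteq> cl (A <#> L)"
      by (intro closure_of_mono mono_set_mult) auto
    then have "K \<subseteq> cl (A <#> L)"
      using AK(2) by simp
    then show "cl (K <#> B) \<subseteq> cl (A <#> L)"
      using closure_set_mult_subset closed_normal_subgroup AL BA
      by (meson closed_normal_def order_trans psubset_imp_subset)
  qed
  moreover have BL: "cl (B <#> L) \<subseteq> C"
    using C LC closed_normal_subgroup
    by (intro closure_set_mult_subset) (auto simp: B_def closed_normal_def)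
  moreover have "B \<subseteq> cl (B <#> L)" "L \<subseteq> cl (B <#> L)"
    using subset_closure_set_mult B D(4) by auto
  ultimately have "associated_factors G T A B K L"
    unfolding associated_factors_def using KC D(5) BA by (auto simp: B_def)
  then show thesis
    using that A B PB BA AQ nonabelian by blast
qed

end

section \<open>Chief factors in a normal series\<close>

theorem theorem1p14:
  fixes G :: "('a, 'b) monoid_scheme" and T :: "'a topology"
    and K L :: "'a set" and S :: "nat \<Rightarrow> 'a set" and n :: nat
  assumes "polish_group G T"
    and "nonabelian_chief_factor G T K L"
    and "S 0 = {\<one>\<^bsub>G\<^esub>}"
    and "S n = carrier G"
    and "\<And>i. i \<le> n \<Longrightarrow> closed_normal G T (S i)"
    and "\<And>i. i < n \<Longrightarrow> S i \<subseteq> S (Suc i)"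
  shows "\<exists>!i. i < n \<and>
    (\<exists>A B. closed_normal G T A \<and> closed_normal G T B \<and>
      S i \<subseteq> B \<and> B \<subseteq> A \<and> A \<subseteq> S (Suc i) \<and>
      nonabelian_chief_factor G T A B \<and> associated_factors G T A B K L)"
proof -
  interpret polish_group G T by fact
  note D = nonabelian_chief_factorD[OF assms(2)]
  let ?C = "mod_centralizer K L"
  let ?P = "\<lambda>i A B. closed_normal G T A \<and> closed_normal G T B \<and>
      S i \<subseteq> B \<and> B \<subseteq> A \<and> A \<subseteq> S (Suc i) \<and>
      nonabelian_chief_factor G T A B \<and> associated_factors G T A B K L"
  have mono: "S i \<subseteq> S j" if "i \<le> j" "j \<le> n" for i j
    using that by (induction rule: dec_induct) (use assms(6) in \<open>auto dest: Suc_le_lessD\<close>)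
  have not_lt: "\<not> i < j" if i: "i < n" "?P i A B" and j: "j < n" "?P j A' B'" for i j A B A' B'
  proof
    assume "i < j"
    then have "A \<subseteq> B'"
      using mono[of "Suc i" j] i j by force
    also have "B' \<subseteq> mod_centralizer A' B'"
      using j normal_subset_mod_centralizer closed_normal_subset by (simp add: closed_normal_def)
    also have "\<dots> = ?C"
      using j D nonabelian_chief_factorD(2) by (intro associated_factors_mod_centralizer_eq) auto
    also have "\<dots> = mod_centralizer A B"
      using i D nonabelian_chief_factorD(2)
      by (intro associated_factors_mod_centralizer_eq[symmetric]) auto
    finally show False
      using nonabelian_chief_factorD(6) i by blast
  qed
  have "\<not> S n \<subseteq> ?C"
    using D(6) closed_normal_subset[OF D(3)] assms(4) by auto
  moreover have "S 0 \<subseteq> ?C"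
    using subgroup.one_closed[OF closed_normal_subgroup[OF closed_normal_mod_centralizer[OF D(4,3)]]]
      assms(3) by simp
  ultimately obtain i where i: "i < n" "S i \<subseteq> ?C" "\<not> S (Suc i) \<subseteq> ?C"
    using ex_least_nat_less[of "\<lambda>i. \<not> S i \<subseteq> ?C" n] by (metis lessI order_refl)
  obtain A B where "?P i A B"
    using associated_nonabelian_chief_factor_between[OF assms(2), of "S i" "S (Suc i)"] i assms(5,6)
    by (metis Suc_leI less_imp_le)
  with i(1) show ?thesis
    using not_lt by (metis linorder_neqE_nat)
qed

end
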